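(* Let $C=(c_{ij})$ be a symmetric $n\times n$ Kalmanson matrix which is also a Robinson matrix, and let $D(C)=(d_{ij})$ be its cut-weight matrix. Then $C$ can be represented as the sum of a weak constant matrix and a conic combination of cut matrices in CDW normal form if and only if $$\sum_{i=1}^{l}d_{ik}\;\le\;\sum_{j=2k+1-l}^{n}d_{k+1,j}$$ holds for all $k=2,\ldots,n-1$ and $l=1,\ldots,k-1$, where the right-hand sum is considered to be zero if $2k+1-l>n$.
   Context: A symmetric $n\times n$ matrix $(c_{ij})$ is a Kalmanson matrix if $c_{ij}+c_{kl}\le c_{ik}+c_{jl}$ and $c_{ik}+c_{jl}\ge c_{il}+c_{jk}$ for all $1\le i<j<k<l\le n$. A symmetric matrix $(c_{ij})$ is a Robinson matrix if $c_{ik}\ge\max\{c_{ij},c_{jk}\}$ for all $i<j<k$. The cut-weight matrix $D(C)=(d_{ij})$ of $C$ has the entries (for $i<j$): $d_{ij}=c_{i-1,j}+c_{i,j+1}-c_{ij}-c_{i-1,j+1}$ for $2\le i<j\le n-1$; $d_{1i}=c_{i+1,1}-c_{i1}$ for $2\le i\le n-1$; $d_{in}=c_{i-1,n}-c_{in}$ for $2\le i\le n-1$. The remaining entries are irrelevant and set to zero. A weak constant matrix is a matrix that can be turned into a constant matrix (all entries equal) by changing the entries on its main diagonal. A conic combination is a linear combination with non-negative coefficients. A cut matrix is an $n\times n$ $0$-$1$ matrix for which there is a partition of $\{1,\ldots,n\}$ into (possibly empty) sets $I_1,\ldots,I_q$ (blocks), with all elements of $I_k$ smaller than all elements of $I_{k+1}$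 for $1\le k\le q-1$, such that the $(i,j)$ entry is $0$ if $i,j$ lie in the same block and $1$ otherwise. It is in CDW normal form if $|I_1|\le|I_2|\le\cdots\le|I_q|$. *)

theory Defs
  imports Complex_Main
begin

text \<open>An \<open>n \<times> n\<close> real matrix is a function on pairs of indices of which only
  the values at \<open>1 \<le> i, j \<le> n\<close> matter. Rows and columns are numbered from 1.\<close>

definition symmetric_matrix :: "nat \<Rightarrow> (nat \<Rightarrow> nat \<Rightarrow> real) \<Rightarrow> bool" where
  "symmetric_matrix n C \<longleftrightarrow> (\<forall>i\<in>{1..n}. \<forall>j\<in>{1..n}. C i j = C j i)"

definition kalmanson_matrix :: "nat \<Rightarrow> (nat \<Rightarrow> nat \<Rightarrow> real) \<Rightarrow> bool" where
  "kalmanson_matrix n C \<longleftrightarrow>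
     symmetric_matrix n C \<and>
     (\<forall>i j k l. 1 \<le> i \<and> i < j \<and> j < k \<and> k < l \<and> l \<le> n \<longrightarrow>
        C i j + C k l \<le> C i k + C j l \<and>
        C i k + C j l \<ge> C i l + C j k)"

definition robinson_matrix :: "nat \<Rightarrow> (nat \<Rightarrow> nat \<Rightarrow> real) \<Rightarrow> bool" where
  "robinson_matrix n C \<longleftrightarrow>
     symmetric_matrix n C \<and>
     (\<forall>i j k. 1 \<le> i \<and> i < j \<and> j < k \<and> k \<le> n \<longrightarrow>
        C i k \<ge> max (C i j) (C j k))"

definition cut_weight :: "nat \<Rightarrow> (nat \<Rightarrow> nat \<Rightarrow> real) \<Rightarrow> nat \<Rightarrow> nat \<Rightarrow> real" where
  "cut_weight n C i j =
     (if 2 \<le> i \<and> i < j \<and> j \<le> n - 1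
        then C (i - 1) j + C i (j + 1) - C i j - C (i - 1) (j + 1)
      else if i = 1 \<and> 2 \<le> j \<and> j \<le> n - 1
        then C (j + 1) 1 - C j 1
      else if j = n \<and> 2 \<le> i \<and> i \<le> n - 1
        then C (i - 1) n - C i n
      else 0)"

definition constant_matrix :: "nat \<Rightarrow> (nat \<Rightarrow> nat \<Rightarrow> real) \<Rightarrow> bool" where
  "constant_matrix n A \<longleftrightarrow> (\<exists>a. \<forall>i\<in>{1..n}. \<forall>j\<in>{1..n}. A i j = a)"

definition weak_constant_matrix :: "nat \<Rightarrow> (nat \<Rightarrow> nat \<Rightarrow> real) \<Rightarrow> bool" where
  "weak_constant_matrix n W \<longleftrightarrow>
     (\<exists>A. constant_matrix n A \<and>
          (\<forall>i\<in>{1..n}. \<forall>j\<in>{1..n}. i \<noteq> j \<longrightarrow> A i j = W i j))"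

text \<open>Blocks may be empty, so the order is required of all pairs of blocks: for
  consecutive blocks only, it would say nothing about two blocks separated by an
  empty one.\<close>

definition block_partition :: "nat \<Rightarrow> nat \<Rightarrow> (nat \<Rightarrow> nat set) \<Rightarrow> bool" where
  "block_partition n q I \<longleftrightarrow>
     (\<Union>k\<in>{1..q}. I k) = {1..n} \<and>
     (\<forall>k l. 1 \<le> k \<and> k < l \<and> l \<le> q \<longrightarrow> (\<forall>i\<in>I k. \<forall>j\<in>I l. i < j))"

definition cut_matrix_of :: "nat \<Rightarrow> nat \<Rightarrow> (nat \<Rightarrow> nat set) \<Rightarrow> (nat \<Rightarrow> nat \<Rightarrow> real) \<Rightarrow> bool" where
  "cut_matrix_of n q I M \<longleftrightarrow>
     block_partition n q I \<and>
     (\<forall>i\<in>{1..n}. \<forall>j\<in>{1..n}.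
        M i j = (if \<exists>k\<in>{1..q}. i \<in> I k \<and> j \<in> I k then 0 else 1))"

definition cdw_cut_matrix :: "nat \<Rightarrow> (nat \<Rightarrow> nat \<Rightarrow> real) \<Rightarrow> bool" where
  "cdw_cut_matrix n M \<longleftrightarrow>
     (\<exists>q I. cut_matrix_of n q I M \<and>
            (\<forall>k. 1 \<le> k \<and> k < q \<longrightarrow> card (I k) \<le> card (I (k + 1))))"

definition conic_combination ::
    "nat \<Rightarrow> ((nat \<Rightarrow> nat \<Rightarrow> real) \<Rightarrow> bool) \<Rightarrow> (nat \<Rightarrow> nat \<Rightarrow> real) \<Rightarrow> bool" where
  "conic_combination n P K \<longleftrightarrow>
     (\<exists>m (a :: nat \<Rightarrow> real) M.
        (\<forall>t<m. a t \<ge> 0 \<and> P (M t)) \<and>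
        (\<forall>i\<in>{1..n}. \<forall>j\<in>{1..n}. K i j = (\<Sum>t<m. a t * M t i j)))"

end

theory Submission
  imports Defs
begin

text \<open>
  Off the diagonal, a cut matrix is the constant 1 minus the indicators of the squares
  \<open>{p..r} \<times> {p..r}\<close> over its blocks \<open>{p..r}\<close> with \<open>p < r\<close>; its singleton blocks leave no
  trace. The cut weight \<open>d p r\<close> is the mixed second difference that recovers the coefficient of
  the square \<open>{p..r} \<times> {p..r}\<close> from \<open>C\<close> (the full square is itself constant, and its coefficient is set
  to 0), and it is nonnegative because \<open>C\<close> is a Kalmanson and
  a Robinson matrix. So the question is when the weights \<open>d\<close> on the intervals can be spread over
  partitions whose block sizes never decrease. The rule for the sizes is local: a block \<open>{i..k}\<close>
  with \<open>k < n\<close> has to be followed by a block \<open>{k + 1..j}\<close> of at least its length, that is with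
  \<open>j \<ge> 2 * k + 1 - i\<close>. A block needs no predecessor, since singletons can fill the space before it.
  Hence all the weight of the intervals ending at \<open>k\<close> has to be matched into the weight of the
  intervals starting at \<open>k + 1\<close>. The admissible successors shrink as \<open>i\<close> decreases, so Hall's
  condition need only be asked for the initial ranges \<open>i \<le> l\<close>, and this is the stated inequality.

  Necessity: by telescoping, both sides of the inequality are differences of entries of \<open>C\<close>
  (\<open>hall_inequality_iff_cut_weight\<close>). In this form the inequality is preserved by conic
  combinations and by adding constants, and \<open>cdw_cut_matrix_hall\<close> checks it for a single cut matrix.

  Sufficiency: \<open>chain_decomposition\<close> builds the partitions from right to left. It removes an
  interval \<open>{i..k}\<close> of positive weight with \<open>k\<close> minimal and then \<open>i\<close> maximal, decomposes the
  rest by induction, and puts the interval in front of a fraction of those partitions in which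
  an admissible \<open>{k + 1..j}\<close> still lacks a predecessor. The single inequality at \<open>(k, i)\<close> says that
  their total weight is large enough. Finally \<open>chain_matrix_cdw\<close> turns the resulting sets of
  intervals back into partitions.
\<close>

section \<open>Telescoping sums of cut weights\<close>

lemma cut_weight_column_sum:
  assumes sym: "symmetric_matrix n C" and l: "1 \<le> l" and k: "l < k" "k < n"
  shows "(\<Sum>i = 1..l. cut_weight n C i k) = C l (k + 1) - C l k"
  using l k(1)
proof (induction l rule: dec_induct)
  case base
  have "C (k + 1) 1 = C 1 (k + 1)" "C k 1 = C 1 k"
    using sym base k(2) by (auto simp: symmetric_matrix_def)
  moreover have "k \<le> n - 1" using k(2) by simp
  ultimately show ?case using base by (simp add: cut_weight_def)
next
  case (step l)
  have "cut_weight n C (Suc l) k = C l k + C (Suc l) (k + 1) - C (Suc l) k - C l (k + 1)"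
  proof -
    have "k \<le> n - 1" using k(2) by simp
    then show ?thesis using step by (simp add: cut_weight_def)
  qed
  then show ?case using step by simp
qed

lemma cut_weight_row_sum:
  assumes p: "2 \<le> p" "p < m" and m: "m \<le> n"
  shows "(\<Sum>j = m..n. cut_weight n C p j) = C (p - 1) m - C p m"
  using m p(2)
proof (induction m rule: inc_induct)
  case base
  then have "p \<le> n - 1" "\<not> n \<le> n - 1" by auto
  then show ?case using p(1) by (simp add: cut_weight_def)
next
  case (step m)
  have "cut_weight n C p m = C (p - 1) m + C p (Suc m) - C p m - C (p - 1) (Suc m)"
    using step p(1) by (auto simp: cut_weight_def)
  then show ?case using step by (simp add: sum.atLeast_Suc_atMost)
qed

lemma cut_weight_first_row_sum:
  assumes sym: "symmetric_matrix n C" and m: "2 \<le> m" "m \<le> n"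
  shows "(\<Sum>j = m..n. cut_weight n C 1 j) = C 1 n - C 1 m"
  using m(2,1)
proof (induction m rule: inc_induct)
  case base
  then have "\<not> n \<le> n - 1" by auto
  then show ?case by (simp add: cut_weight_def)
next
  case (step m)
  have "C (Suc m) 1 = C 1 (Suc m)" "C m 1 = C 1 m"
    using sym step by (auto simp: symmetric_matrix_def)
  then have "cut_weight n C 1 m = C 1 (Suc m) - C 1 m"
    using step by (auto simp: cut_weight_def)
  then show ?case using step by (simp add: sum.atLeast_Suc_atMost)
qed

text \<open>
  An off-diagonal entry of \<open>C\<close> lies below \<open>C 1 n\<close> by exactly the total weight of the intervals
  that contain both of its indices: the cut weights invert a double summation.
\<close>
lemma cut_weight_quadrant_sum:
  assumes sym: "symmetric_matrix n C" and x: "1 \<le> x" "x < y" "y \<le> n"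
  shows "(\<Sum>p = 1..x. \<Sum>r = y..n. cut_weight n C p r) = C 1 n - C x y"
  using x(1,2)
proof (induction x rule: dec_induct)
  case base
  then show ?case using cut_weight_first_row_sum[OF sym, of y] x(3) by simp
next
  case (step x)
  then show ?case using cut_weight_row_sum[of "Suc x" y n C] x(3) by simp
qed

lemma cut_weight_nonzero_range:
  assumes "cut_weight n C p r \<noteq> 0"
  shows "1 \<le> p \<and> p < r \<and> r \<le> n"
proof -
  consider "2 \<le> p" "p < r" "r \<le> n - 1" | "p = 1" "2 \<le> r" "r \<le> n - 1"
    | "r = n" "2 \<le> p" "p \<le> n - 1"
    using assms unfolding cut_weight_def by presburger
  then show ?thesis by cases auto
qed

text \<open>
  The two parts of the hypothesis on \<open>C\<close> share the work: the Kalmanson inequality for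
  \<open>i - 1 < i < j < j + 1\<close> handles the inner intervals, and monotonicity along rows and columns
  handles those that touch 1 or \<open>n\<close>.
\<close>
lemma cut_weight_nonneg:
  assumes K: "kalmanson_matrix n C" and R: "robinson_matrix n C"
  shows "0 \<le> cut_weight n C i j"
proof -
  have sym: "C a b = C b a" if "1 \<le> a" "1 \<le> b" "a \<le> n" "b \<le> n" for a b
    using R that by (auto simp: robinson_matrix_def symmetric_matrix_def)
  have rob: "C a c \<ge> C a b" "C a c \<ge> C b c" if "1 \<le> a" "a < b" "b < c" "c \<le> n" for a b c
    using R that by (auto simp: robinson_matrix_def)
  consider "2 \<le> i" "i < j" "j \<le> n - 1" | "i = 1" "2 \<le> j" "j \<le> n - 1"
    | "j = n" "2 \<le> i" "i \<le> n - 1"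
    | "\<not> (2 \<le> i \<and> i < j \<and> j \<le> n - 1)" "\<not> (i = 1 \<and> 2 \<le> j \<and> j \<le> n - 1)"
      "\<not> (j = n \<and> 2 \<le> i \<and> i \<le> n - 1)"
    by blast
  then show ?thesis
  proof cases
    case 1
    have "C (i - 1) j + C i (j + 1) \<ge> C (i - 1) (j + 1) + C i j"
      using K 1 unfolding kalmanson_matrix_def
      by (elim conjE allE[of _ "i - 1"] allE[of _ i] allE[of _ j] allE[of _ "j + 1"]) auto
    then show ?thesis using 1 by (simp add: cut_weight_def)
  next
    case 2
    then show ?thesis using rob(1)[of 1 j "j + 1"] sym[of 1 j] sym[of 1 "j + 1"]
      by (simp add: cut_weight_def)
  next
    case 3
    then have "1 \<le> i - 1" "i < n" "\<not> n \<le> n - 1" by auto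
    then show ?thesis using 3 rob(2)[of "i - 1" i n] by (simp add: cut_weight_def)
  next
    case 4
    then have "cut_weight n C i j = 0" unfolding cut_weight_def by presburger
    then show ?thesis by simp
  qed
qed

section \<open>Necessity of the inequalities\<close>

text \<open>
  Hall's condition at \<open>(k, l)\<close> after telescoping. It involves only off-diagonal entries and only
  their differences, so it is visibly linear in \<open>C\<close> and blind to weak constant matrices.
\<close>
definition hall_inequality :: "nat \<Rightarrow> (nat \<Rightarrow> nat \<Rightarrow> real) \<Rightarrow> nat \<Rightarrow> nat \<Rightarrow> bool" where
  "hall_inequality n C k l \<longleftrightarrow>
     C l (k + 1) - C l k
       \<le> (if 2 * k + 1 - l \<le> n then C k (2 * k + 1 - l) - C (k + 1) (2 * k + 1 - l) else 0)"

lemma hall_inequality_iff_cut_weight: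
  assumes sym: "symmetric_matrix n C" and l: "1 \<le> l" "l < k" "k < n"
  shows "hall_inequality n C k l \<longleftrightarrow>
    (\<Sum>i = 1..l. cut_weight n C i k) \<le> (\<Sum>j = 2 * k + 1 - l..n. cut_weight n C (k + 1) j)"
  using cut_weight_column_sum[OF assms] cut_weight_row_sum[of "k + 1" "2 * k + 1 - l" n C] l
  by (auto simp: hall_inequality_def)

text \<open>
  The left-hand side can be positive only if a block contains \<open>l\<close> and ends at \<open>k\<close>. Such a block
  has at least \<open>k - l + 1\<close> elements, and so has the next nonempty one, which starts at \<open>k + 1\<close> and
  therefore reaches \<open>m = 2 * k + 1 - l\<close>. Then the right-hand side is 1. It is never negative
  because blocks are intervals.
\<close>
lemma cdw_cut_matrix_hall:
  assumes M: "cdw_cut_matrix n M" and l: "1 \<le> l" "l < k" "k < n"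
  shows "hall_inequality n M k l"
proof -
  obtain q I where part: "block_partition n q I"
    and Mval: "\<And>i j. \<lbrakk>i \<in> {1..n}; j \<in> {1..n}\<rbrakk> \<Longrightarrow>
       M i j = (if \<exists>k\<in>{1..q}. i \<in> I k \<and> j \<in> I k then 0 else 1)"
    and card_step: "\<And>k. \<lbrakk>1 \<le> k; k < q\<rbrakk> \<Longrightarrow> card (I k) \<le> card (I (k + 1))"
    using M unfolding cdw_cut_matrix_def cut_matrix_of_def by blast
  have "\<exists>u\<in>{1..q}. x \<in> I u" if "x \<in> {1..n}" for x
    using part that unfolding block_partition_def by blast
  then obtain b where b: "\<And>x. x \<in> {1..n} \<Longrightarrow> b x \<in> {1..q} \<and> x \<in> I (b x)" by metis
  have ord: "i < j" if "u \<in> {1..q}" "v \<in> {1..q}" "u < v" "i \<in> I u" "j \<in> I v" for u v i j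
    using part that unfolding block_partition_def by auto
  \<comment> \<open>\<open>b\<close> numbers the blocks; it is a monotone function, and all that matters about the partition.\<close>
  have bu: "b x = u" if "x \<in> {1..n}" "u \<in> {1..q}" "x \<in> I u" for x u
    using b[OF that(1)] that ord[of u "b x" x x] ord[of "b x" u x x] by force
  have mono: "b x \<le> b y" if "x \<in> {1..n}" "y \<in> {1..n}" "x \<le> y" for x y
    using b[OF that(1)] b[OF that(2)] ord[of "b y" "b x" y x] that(3) by force
  have Mb: "M x y = (if b x = b y then 0 else 1)" if "x \<in> {1..n}" "y \<in> {1..n}" for x y
  proof -
    have "(\<exists>u\<in>{1..q}. x \<in> I u \<and> y \<in> I u) \<longleftrightarrow> b x = b y"
      using bu[OF that(1)] bu[OF that(2)] b[OF that(1)] b[OF that(2)] by metis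
    then show ?thesis using Mval[OF that] by simp
  qed
  have Isub: "I u \<subseteq> {1..n}" if "u \<in> {1..q}" for u
    using part that unfolding block_partition_def by blast
  define m where "m = 2 * k + 1 - l"
  have inr: "l \<in> {1..n}" "k \<in> {1..n}" "k + 1 \<in> {1..n}" using l by auto
  have m: "k + 1 < m" using l by (simp add: m_def)
  have next_block: "m \<le> n \<and> b m = b (k + 1)" if same: "b l = b k" and diff: "b k \<noteq> b (k + 1)"
  proof (rule ccontr)
    assume neg: "\<not> (m \<le> n \<and> b m = b (k + 1))"
    let ?u = "b k" and ?v = "b (k + 1)"
    have uv: "?u < ?v" using mono[of k "k + 1"] diff inr by simp
    \<comment> \<open>Empty blocks may stand between the two, so the size comparison is iterated.\<close>
    have card_mono': "card (I ?u) \<le> card (I ?v)"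
    proof -
      have "?u \<le> v \<longrightarrow> v \<le> q \<longrightarrow> card (I ?u) \<le> card (I v)" for v
      proof (induction v)
        case (Suc v)
        then show ?case using card_step[of v] b[OF inr(2)]
          by (auto simp: le_Suc_eq intro: order_trans)
      qed (use b[OF inr(2)] in auto)
      then show ?thesis using uv b[OF inr(3)] by auto
    qed
    have "{l..k} \<subseteq> I ?u"
    proof
      fix x assume x: "x \<in> {l..k}"
      then have "b x = ?u" using mono[of l x] mono[of x k] inr same by auto
      then show "x \<in> I ?u" using b[of x] x inr by auto
    qed
    then have "card {l..k} \<le> card (I ?u)"
      using Isub[of ?u] b[OF inr(2)] by (intro card_mono) (auto intro: finite_subset)
    moreover have "I ?v \<subseteq> {k<..<m}"
    proof
      fix x assume x: "x \<in> I ?v"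
      then have xr: "x \<in> {1..n}" and bx: "b x = ?v"
        using Isub[of ?v] bu[of x ?v] b[OF inr(3)] by auto
      have "x < m"
      proof (rule ccontr)
        assume "\<not> x < m"
        then have "b m = ?v" "m \<le> n" using mono[of "k + 1" m] mono[of m x] xr bx m by auto
        then show False using neg by simp
      qed
      then show "x \<in> {k<..<m}"
        using ord[of ?u ?v k x] b[OF inr(2)] b[OF inr(3)] uv x by auto
    qed
    then have "card (I ?v) \<le> card {k<..<m}" by (intro card_mono) auto
    ultimately show False using card_mono' l by (simp add: m_def)
  qed
  have "M l (k + 1) - M l k \<le> (if m \<le> n then M k m - M (k + 1) m else 0)"
  proof (cases "b l = b k \<and> b k \<noteq> b (k + 1)")
    case True
    then have "m \<le> n" "b m = b (k + 1)" using next_block by blast+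
    then show ?thesis using True m inr by (simp add: Mb)
  next
    case False
    then have "M l (k + 1) - M l k \<le> 0" using inr by (auto simp: Mb)
    also have "0 \<le> (if m \<le> n then M k m - M (k + 1) m else 0)"
    proof (cases "m \<le> n")
      case True
      then have "b k \<le> b (k + 1)" "b (k + 1) \<le> b m"
        using mono[of k "k + 1"] mono[of "k + 1" m] inr m by auto
      then show ?thesis using True inr m by (simp add: Mb)
    qed simp
    finally show ?thesis .
  qed
  then show ?thesis unfolding hall_inequality_def m_def .
qed

lemma hall_if_representable:
  assumes W: "weak_constant_matrix n W" and K: "conic_combination n (cdw_cut_matrix n) K"
    and C: "\<And>i j. \<lbrakk>i \<in> {1..n}; j \<in> {1..n}\<rbrakk> \<Longrightarrow> C i j = W i j + K i j"
    and l: "1 \<le> l" "l < k" "k < n"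
  shows "hall_inequality n C k l"
proof -
  obtain w where w: "\<And>i j. \<lbrakk>i \<in> {1..n}; j \<in> {1..n}; i \<noteq> j\<rbrakk> \<Longrightarrow> W i j = w"
    using W unfolding weak_constant_matrix_def constant_matrix_def by metis
  obtain m and a :: "nat \<Rightarrow> real" and M where "\<forall>t<m. 0 \<le> a t \<and> cdw_cut_matrix n (M t)"
    and "\<forall>i\<in>{1..n}. \<forall>j\<in>{1..n}. K i j = (\<Sum>t<m. a t * M t i j)"
    using K unfolding conic_combination_def by blast
  then have M: "\<And>t. t < m \<Longrightarrow> 0 \<le> a t \<and> cdw_cut_matrix n (M t)"
    and Kval: "\<And>i j. \<lbrakk>i \<in> {1..n}; j \<in> {1..n}\<rbrakk> \<Longrightarrow> K i j = (\<Sum>t<m. a t * M t i j)"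
    by blast+
  have val: "C i j = w + (\<Sum>t<m. a t * M t i j)"
    if "i \<in> {1..n}" "j \<in> {1..n}" "i \<noteq> j" for i j
    using C w Kval that by simp
  let ?s = "2 * k + 1 - l"
  have "(\<Sum>t<m. a t * (M t l (k + 1) - M t l k))
      \<le> (\<Sum>t<m. a t * (if ?s \<le> n then M t k ?s - M t (k + 1) ?s else 0))"
    using M cdw_cut_matrix_hall[OF _ l]
    by (intro sum_mono mult_left_mono) (auto simp: hall_inequality_def)
  then show ?thesis
    unfolding hall_inequality_def using l
    by (cases "?s \<le> n") (simp_all add: val sum_subtractf right_diff_distrib)
qed

section \<open>Chains of blocks\<close>

lemma sum_sum_list_swap:
  fixes f :: "'a \<Rightarrow> 'b \<Rightarrow> 'c::comm_monoid_add"
  shows "(\<Sum>x\<in>X. \<Sum>y\<leftarrow>L. f x y) = (\<Sum>y\<leftarrow>L. \<Sum>x\<in>X. f x y)"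
  by (induction L) (simp_all add: sum.distrib)

lemma sum_if_unique:
  fixes a :: "'b::comm_monoid_add"
  assumes "finite X" and "\<And>x y. \<lbrakk>x \<in> X; y \<in> X; P x; P y\<rbrakk> \<Longrightarrow> x = y"
  shows "(\<Sum>x\<in>X. if P x then a else 0) = (if \<exists>x\<in>X. P x then a else 0)"
proof (cases "\<exists>x\<in>X. P x")
  case True
  then obtain z where "z \<in> X" "P z" by blast
  then have "(\<Sum>x\<in>X. if P x then a else 0) = (\<Sum>x\<in>X. if x = z then a else 0)"
    using assms(2) by (intro sum.cong) auto
  then show ?thesis using \<open>z \<in> X\<close> \<open>P z\<close> assms(1) by auto
qed auto

text \<open>
  A partition in CDW normal form, recorded by its blocks with at least two elements. Leaving out
  the singletons makes every chain extendable on the left without changing the rest, and keeps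
  the weights of the recorded intervals the only data. The third condition bounds the length of a
  successor from below without truncating subtraction.
\<close>
definition cdw_chain :: "nat \<Rightarrow> (nat \<times> nat) set \<Rightarrow> bool" where
  "cdw_chain n S \<longleftrightarrow>
     (\<forall>p r. (p, r) \<in> S \<longrightarrow> 1 \<le> p \<and> p < r \<and> r \<le> n) \<and>
     (\<forall>p r p' r'. (p, r) \<in> S \<and> (p', r') \<in> S \<longrightarrow> p = p' \<and> r = r' \<or> r < p' \<or> r' < p) \<and>
     (\<forall>p r. (p, r) \<in> S \<and> r < n \<longrightarrow> (\<exists>j. (r + 1, j) \<in> S \<and> 2 * r + 1 \<le> j + p))"

lemma cdw_chainD:
  assumes "cdw_chain n S"
  shows "(p, r) \<in> S \<Longrightarrow> 1 \<le> p \<and> p < r \<and> r \<le> n"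
    and "\<lbrakk>(p, r) \<in> S; (p', r') \<in> S\<rbrakk> \<Longrightarrow> p = p' \<and> r = r' \<or> r < p' \<or> r' < p"
    and "\<lbrakk>(p, r) \<in> S; r < n\<rbrakk> \<Longrightarrow> \<exists>j. (r + 1, j) \<in> S \<and> 2 * r + 1 \<le> j + p"
  using assms unfolding cdw_chain_def by blast+

lemma cdw_chain_singleton: "\<lbrakk>1 \<le> i; i < n\<rbrakk> \<Longrightarrow> cdw_chain n {(i, n)}"
  by (auto simp: cdw_chain_def)

lemma cdw_chain_prepend:
  assumes S: "cdw_chain n S" and i: "1 \<le> i" "i < k"
    and next_block: "(k + 1, j) \<in> S" "2 * k + 1 \<le> j + i"
    and first: "\<And>p r. (p, r) \<in> S \<Longrightarrow> k < r"
  shows "cdw_chain n (insert (i, k) S)"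
proof -
  have later: "k < p" if "(p, r) \<in> S" for p r
    using cdw_chainD(2)[OF S next_block(1) that] first[OF that] cdw_chainD(1)[OF S next_block(1)] by auto
  have "k \<le> n" using cdw_chainD(1)[OF S next_block(1)] by simp
  then show ?thesis
    using S i next_block later unfolding cdw_chain_def by (auto 0 4)
qed

text \<open>
  Weighted families are lists, not functions on sets of chains: the decomposition splits a
  chain into copies that carry different weights, and the copies need not be merged.
\<close>
definition chain_load :: "(real \<times> (nat \<times> nat) set) list \<Rightarrow> nat \<Rightarrow> nat \<Rightarrow> real" where
  "chain_load L p r = (\<Sum>(a, S)\<leftarrow>L. if (p, r) \<in> S then a else 0)"

lemma chain_load_Nil [simp]: "chain_load [] p r = 0"
  by (simp add: chain_load_def)

lemma chain_load_Cons [simp]: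
  "chain_load (aS # L) p r = (if (p, r) \<in> snd aS then fst aS else 0) + chain_load L p r"
  by (simp add: chain_load_def split: prod.splits)

lemma chain_load_append [simp]: "chain_load (L @ L') p r = chain_load L p r + chain_load L' p r"
  by (simp add: chain_load_def)

lemma chain_load_pos:
  assumes "\<And>a S. (a, S) \<in> set L \<Longrightarrow> 0 \<le> a" and "(a, S) \<in> set L" "0 < a" "(p, r) \<in> S"
  shows "0 < chain_load L p r"
proof -
  have nn: "0 \<le> chain_load L' p r" if "set L' \<subseteq> set L" for L'
    using assms(1) that by (induction L') auto
  obtain xs ys where L: "L = xs @ (a, S) # ys" using assms(2) by (meson split_list)
  have "0 \<le> chain_load xs p r" "0 \<le> chain_load ys p r" using L by (auto intro!: nn)
  then show ?thesis using assms(3,4) by (simp add: L)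
qed

text \<open>
  A fraction \<open>\<theta>\<close> of each selected chain receives the new interval, the rest stays as it was; so
  the load changes at the new interval only.
\<close>
lemma chain_load_split:
  assumes "\<And>aS. \<lbrakk>aS \<in> set L; T aS\<rbrakk> \<Longrightarrow> (i, k) \<notin> snd aS"
  shows "chain_load (map (\<lambda>aS. (if T aS then (1 - \<theta>) * fst aS else fst aS, snd aS)) L
           @ map (\<lambda>aS. (\<theta> * fst aS, insert (i, k) (snd aS))) (filter T L)) p r
       = chain_load L p r + (if p = i \<and> r = k then \<theta> * (\<Sum>aS\<leftarrow>filter T L. fst aS) else 0)"
  using assms by (induction L) (auto simp: algebra_simps)

section \<open>Decomposing interval weights into chains\<close>

text \<open>
  The order of removal makes the induction work. As \<open>k\<close> is the least right end, no interval
  of positive weight lies to the left of \<open>{i..k}\<close>, so removing it cannot violate the conditions at \<open>i - 1\<close>. As \<open>i\<close> is maximal,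
  \<open>{i..k}\<close> is the least demanding of the intervals of positive weight ending at \<open>k\<close>. In the decomposition of the rest,
  the chains through an admissible successor have total weight \<open>\<Sum>j = 2 * k + 1 - i..n. d (k + 1) j\<close>,
  and at most \<open>(\<Sum>p = 1..i. d p k) - d i k\<close> of it has been used up by other intervals ending at \<open>k\<close>.
  The condition for \<open>l = i\<close> thus leaves at least \<open>d i k\<close>, whichever decomposition of the rest was
  chosen.
\<close>
lemma chain_decomposition:
  fixes d :: "nat \<Rightarrow> nat \<Rightarrow> real"
  assumes "\<And>p r. 0 \<le> d p r"
    and "\<And>p r. d p r \<noteq> 0 \<Longrightarrow> 1 \<le> p \<and> p < r \<and> r \<le> n"
    and "\<And>k l. \<lbrakk>1 \<le> l; l < k; k < n\<rbrakk> \<Longrightarrow>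
           (\<Sum>i = 1..l. d i k) \<le> (\<Sum>j = 2 * k + 1 - l..n. d (k + 1) j)"
  shows "\<exists>L. (\<forall>(a, S)\<in>set L. 0 \<le> a \<and> cdw_chain n S) \<and> (\<forall>p r. chain_load L p r = d p r)"
  using assms
proof (induction "card {(p, r). d p r \<noteq> 0}" arbitrary: d rule: less_induct)
  case less
  note nonneg = less.prems(1) and range = less.prems(2) and hall = less.prems(3)
  have fin: "finite {(p, r). d p r \<noteq> 0}"
    by (rule finite_subset[of _ "{1..n} \<times> {1..n}"]) (use range in force)+
  show ?case
  proof (cases "\<exists>r p. d p r \<noteq> 0")
    case False
    then show ?thesis by (intro exI[of _ "[]"]) auto
  next
    case True
    define k where "k = (LEAST r. \<exists>p. d p r \<noteq> 0)"
    have k_end: "\<exists>p. d p k \<noteq> 0" unfolding k_def using True by (rule LeastI_ex)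
    have kmin: "d p r = 0" if "r < k" for p r
      using not_less_Least[of r "\<lambda>r. \<exists>p. d p r \<noteq> 0"] that unfolding k_def by auto
    define i where "i = Max {p. d p k \<noteq> 0}"
    have fin_k: "finite {p. d p k \<noteq> 0}"
      by (rule finite_subset[of _ "{1..n}"]) (use range in force)+
    have i: "d i k \<noteq> 0" using Max_in[OF fin_k] k_end unfolding i_def by blast
    have imax: "p \<le> i" if "d p k \<noteq> 0" for p using Max_ge[OF fin_k] that unfolding i_def by blast
    have ik: "1 \<le> i" "i < k" "k \<le> n" using range[OF i] by auto
    \<comment> \<open>The weights that remain when \<open>{i..k}\<close> is removed.\<close>
    define d' where "d' = (\<lambda>p r. if p = i \<and> r = k then 0 else d p r)"
    have d'_le: "d' p r \<le> d p r" for p r using nonneg by (simp add: d'_def)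
    have "{(p, r). d' p r \<noteq> 0} \<subset> {(p, r). d p r \<noteq> 0}"
      using i by (auto simp: d'_def)
    then have "card {(p, r). d' p r \<noteq> 0} < card {(p, r). d p r \<noteq> 0}"
      by (rule psubset_card_mono[OF fin])
    moreover have "(\<Sum>p = 1..l'. d' p k') \<le> (\<Sum>j = 2 * k' + 1 - l'..n. d' (k' + 1) j)"
      if "1 \<le> l'" "l' < k'" "k' < n" for k' l'
    proof (cases "k' + 1 = i")
      case True
      then have "(\<Sum>p = 1..l'. d' p k') = 0" using kmin ik by (simp add: d'_def)
      then show ?thesis using nonneg by (auto simp: d'_def intro!: sum_nonneg)
    next
      case False
      have "(\<Sum>p = 1..l'. d' p k') \<le> (\<Sum>p = 1..l'. d p k')" by (intro sum_mono d'_le)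
      also have "\<dots> \<le> (\<Sum>j = 2 * k' + 1 - l'..n. d (k' + 1) j)" using hall that by blast
      also have "\<dots> = (\<Sum>j = 2 * k' + 1 - l'..n. d' (k' + 1) j)" using False by (simp add: d'_def)
      finally show ?thesis .
    qed
    moreover have "0 \<le> d' p r" for p r using nonneg by (simp add: d'_def)
    moreover have "1 \<le> p \<and> p < r \<and> r \<le> n" if "d' p r \<noteq> 0" for p r
      using range[of p r] that by (simp add: d'_def split: if_splits)
    ultimately obtain L where L: "\<And>a S. (a, S) \<in> set L \<Longrightarrow> 0 \<le> a \<and> cdw_chain n S"
      and load: "\<And>p r. chain_load L p r = d' p r"
      using less.hyps[of d'] by fast
    have used: "d' p r \<noteq> 0" if "(a, S) \<in> set L" "0 < a" "(p, r) \<in> S" for a S p r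
      using chain_load_pos[of L a S p r] L that load by force
    show ?thesis
    proof (cases "k = n")
      case True
      then show ?thesis
        using L load i ik nonneg[of i n] cdw_chain_singleton[of i n]
        by (intro exI[of _ "(d i n, {(i, n)}) # L"]) (auto simp: d'_def)
    next
      case False
      \<comment> \<open>\<open>T\<close> selects the chains of positive weight that \<open>{i..k}\<close> can be prepended to: an
        admissible successor is present and no block ends at \<open>k\<close> yet. Chains of weight 0 are left out
        because they may contain intervals on which \<open>d'\<close> vanishes.\<close>
      define T where "T = (\<lambda>aS :: real \<times> (nat \<times> nat) set. 0 < fst aS \<and>
        (\<exists>j. (k + 1, j) \<in> snd aS \<and> 2 * k + 1 \<le> j + i) \<and> (\<forall>p. (p, k) \<notin> snd aS))"
      define A where "A = (\<Sum>aS\<leftarrow>filter T L. fst aS)"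
      let ?J = "{2 * k + 1 - i..n}"
      \<comment> \<open>Chain by chain: where an admissible successor occurs, either the chain is free or
        another interval ending at \<open>k\<close> occupies it. Each sum has at most one nonzero term.\<close>
      have le: "(\<Sum>j\<in>?J. if (k + 1, j) \<in> S then a else 0)
          \<le> (if T (a, S) then a else 0) + (\<Sum>p = 1..i. if (p, k) \<in> S then a else 0)"
        if aS: "(a, S) \<in> set L" for a S
      proof -
        have a: "0 \<le> a" and S: "cdw_chain n S" using L[OF aS] by auto
        have 1: "(\<Sum>j\<in>?J. if (k + 1, j) \<in> S then a else 0)
            = (if \<exists>j\<in>?J. (k + 1, j) \<in> S then a else 0)"
          by (rule sum_if_unique) (use cdw_chainD(1,2)[OF S] in fastforce)+
        have 2: "(\<Sum>p = 1..i. if (p, k) \<in> S then a else 0)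
            = (if \<exists>p\<in>{1..i}. (p, k) \<in> S then a else 0)"
          by (rule sum_if_unique) (use cdw_chainD(1,2)[OF S] in fastforce)+
        have 3: "p \<in> {1..i}" if "0 < a" "(p, k) \<in> S" for p
          using used[OF aS that] imax cdw_chainD(1)[OF S that(2)]
          by (auto simp: d'_def split: if_splits)
        show ?thesis
        proof (cases "0 < a \<and> (\<exists>j\<in>?J. (k + 1, j) \<in> S)")
          case True
          then obtain j where "0 < a" "(k + 1, j) \<in> S" "2 * k + 1 \<le> j + i" by auto
          then have "T (a, S) \<or> (\<exists>p\<in>{1..i}. (p, k) \<in> S)"
            using 3 unfolding T_def fst_conv snd_conv by blast
          then show ?thesis unfolding 1 2 using a by auto
        next
          case False
          then show ?thesis unfolding 1 2 using a by auto
        qed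
      qed
      have filt: "(\<Sum>aS\<leftarrow>L'. if T aS then fst aS else 0) = (\<Sum>aS\<leftarrow>filter T L'. fst aS)" for L'
        by (induction L') auto
      have "(\<Sum>p = 1..i. d p k) \<le> (\<Sum>j\<in>?J. d (k + 1) j)"
        using hall[of i k] ik False by simp
      also have "\<dots> = (\<Sum>j\<in>?J. d' (k + 1) j)" using ik by (simp add: d'_def)
      also have "\<dots> = (\<Sum>(a, S)\<leftarrow>L. \<Sum>j\<in>?J. if (k + 1, j) \<in> S then a else 0)"
        unfolding load[symmetric] chain_load_def
        by (subst sum_sum_list_swap) (simp add: case_prod_unfold)
      also have "\<dots> \<le> (\<Sum>(a, S)\<leftarrow>L. (if T (a, S) then a else 0)
            + (\<Sum>p = 1..i. if (p, k) \<in> S then a else 0))"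
        by (rule sum_list_mono) (use le in auto)
      also have "\<dots> = A + (\<Sum>p = 1..i. d' p k)"
        unfolding load[symmetric] chain_load_def A_def filt[symmetric]
        by (subst sum_sum_list_swap) (simp add: case_prod_unfold sum_list_addf)
      also have "(\<Sum>p = 1..i. d' p k) = (\<Sum>p = 1..i. d p k) - d i k"
      proof -
        have "(\<Sum>p = 1..i. d' p k) = (\<Sum>p = 1..i. d p k - (if p = i then d i k else 0))"
          by (intro sum.cong) (auto simp: d'_def)
        then show ?thesis using ik by (simp add: sum_subtractf)
      qed
      finally have A: "d i k \<le> A" by simp
      \<comment> \<open>The share of the free weight \<open>A\<close> that \<open>{i..k}\<close> uses.\<close>
      define \<theta> where "\<theta> = d i k / A"
      have dpos: "0 < d i k" using i nonneg[of i k] by simp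
      have \<theta>: "0 \<le> \<theta>" "\<theta> \<le> 1" "\<theta> * A = d i k" using A dpos by (auto simp: \<theta>_def)
      define L' where "L' = map (\<lambda>aS. (if T aS then (1 - \<theta>) * fst aS else fst aS, snd aS)) L
           @ map (\<lambda>aS. (\<theta> * fst aS, insert (i, k) (snd aS))) (filter T L)"
      have "chain_load L' p r = d p r" for p r
      proof -
        have "chain_load L' p r = d' p r + (if p = i \<and> r = k then \<theta> * A else 0)"
          unfolding L'_def A_def load[symmetric] by (rule chain_load_split) (simp add: T_def)
        then show ?thesis by (simp add: \<theta>(3) d'_def)
      qed
      moreover have "cdw_chain n (insert (i, k) S)" if aS: "(a, S) \<in> set L" "T (a, S)" for a S
      proof -
        obtain j where a: "0 < a" and j: "(k + 1, j) \<in> S" "2 * k + 1 \<le> j + i"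
          and nok: "\<And>p. (p, k) \<notin> S"
          using aS(2) by (auto simp: T_def)
        have "k < r" if "(p, r) \<in> S" for p r
          using used[OF aS(1) a that] kmin[of r p] nok[of p] that
          by (cases "r < k") (auto simp: d'_def not_less le_less split: if_splits)
        then show ?thesis using cdw_chain_prepend[OF _ ik(1,2) j] L[OF aS(1)] by blast
      qed
      then have "\<forall>(a, S)\<in>set L'. 0 \<le> a \<and> cdw_chain n S"
        using L \<theta>(1,2) unfolding L'_def by (fastforce split: if_splits)
      ultimately show ?thesis by blast
    qed
  qed
qed

section \<open>Cut matrices of chains\<close>

definition chain_matrix :: "(nat \<times> nat) set \<Rightarrow> nat \<Rightarrow> nat \<Rightarrow> real" where
  "chain_matrix S x y =
     (if x = y \<or> (\<exists>(p, r)\<in>S. p \<le> min x y \<and> max x y \<le> r) then 0 else 1)"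

text \<open>
  The blocks are numbered by counting: \<open>B\<close> is the set of first elements of blocks, singletons
  included, and \<open>rank x\<close> counts those up to \<open>x\<close>. This is a monotone function that jumps exactly at
  the elements of \<open>B\<close>, so its level sets are the blocks in increasing order, none of them empty.
\<close>
lemma chain_matrix_cdw:
  assumes S: "cdw_chain n S"
  shows "cdw_cut_matrix n (chain_matrix S)"
proof -
  define B where "B = {x\<in>{1..n}. \<not> (\<exists>(p, r)\<in>S. p < x \<and> x \<le> r)}"
  define rank where "rank = (\<lambda>x. card {y\<in>B. y \<le> x})"
  define I where "I = (\<lambda>t. {x\<in>{1..n}. rank x = t})"
  define q where "q = card B"
  have finB: "finite B" by (simp add: B_def)
  have mono: "rank x \<le> rank y" if "x \<le> y" for x y
    unfolding rank_def using that finB by (intro card_mono) auto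
  have strict: "rank x < rank y" if "x < b" "b \<le> y" "b \<in> B" for x y b
  proof -
    have "b \<in> {z\<in>B. z \<le> y}" "b \<notin> {z\<in>B. z \<le> x}" using that by auto
    moreover have "{z\<in>B. z \<le> x} \<subseteq> {z\<in>B. z \<le> y}" using that by auto
    ultimately show ?thesis unfolding rank_def using finB by (intro psubset_card_mono) auto
  qed
  have const: "rank x = rank y" if "x \<le> y" "\<And>b. \<lbrakk>x < b; b \<le> y\<rbrakk> \<Longrightarrow> b \<notin> B" for x y
  proof -
    have "{z\<in>B. z \<le> x} = {z\<in>B. z \<le> y}" using that by (auto simp: not_le[symmetric])
    then show ?thesis by (simp add: rank_def)
  qed
  have same_block: "rank x = rank y \<longleftrightarrow> x = y \<or> (\<exists>(p, r)\<in>S. p \<le> x \<and> y \<le> r)"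
    if xy: "x \<in> {1..n}" "y \<in> {1..n}" "x \<le> y" for x y
  proof (intro iffI)
    assume eq: "rank x = rank y"
    show "x = y \<or> (\<exists>(p, r)\<in>S. p \<le> x \<and> y \<le> r)"
    proof (cases "x = y")
      case False
      have cover: "\<exists>p r. (p, r) \<in> S \<and> p < b \<and> b \<le> r" if "x < b" "b \<le> y" for b
        using strict[of x b y] that eq xy unfolding B_def by fastforce
      obtain p r where pr: "(p, r) \<in> S" "p < x + 1" "x + 1 \<le> r"
        using cover[of "x + 1"] False xy by auto
      have "y \<le> r"
      proof (rule ccontr)
        assume "\<not> y \<le> r"
        then obtain p' r' where "(p', r') \<in> S" "p' < r + 1" "r + 1 \<le> r'"
          using cover[of "r + 1"] pr by auto
        then show False using cdw_chainD(2)[OF S pr(1), of p' r'] cdw_chainD(1)[OF S pr(1)]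
          pr by auto
      qed
      then show ?thesis using pr by force
    qed simp
  next
    assume "x = y \<or> (\<exists>(p, r)\<in>S. p \<le> x \<and> y \<le> r)"
    then show "rank x = rank y"
      using xy by (auto simp: B_def intro!: const) force
  qed
  have rank_range: "rank x \<in> {1..q}" if "x \<in> {1..n}" for x
  proof -
    have "1 \<in> B" using that cdw_chainD(1)[OF S] by (force simp: B_def)
    then have "rank 0 < rank x" using strict[of 0 1 x] that by simp
    moreover have "rank x \<le> q" unfolding rank_def q_def using finB by (intro card_mono) auto
    ultimately show ?thesis by simp
  qed
  have onto: "rank ` B = {1..q}"
  proof (rule card_subset_eq)
    show "rank ` B \<subseteq> {1..q}" using rank_range by (force simp: B_def)
    have "inj_on rank B"
      using strict by (intro linorder_inj_onI') fastforce
    then show "card (rank ` B) = card {1..q}" by (simp add: card_image q_def)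
  qed simp
  have part: "block_partition n q I"
    unfolding block_partition_def
  proof (intro conjI allI impI ballI)
    show "(\<Union>t\<in>{1..q}. I t) = {1..n}" using rank_range by (force simp: I_def)
    fix t u i j assume "1 \<le> t \<and> t < u \<and> u \<le> q" "i \<in> I t" "j \<in> I u"
    then show "i < j" using mono[of j i] by (auto simp: I_def not_less[symmetric])
  qed
  have "chain_matrix S x y = (if \<exists>t\<in>{1..q}. x \<in> I t \<and> y \<in> I t then 0 else 1)"
    if xy: "x \<in> {1..n}" "y \<in> {1..n}" for x y
  proof -
    have "(\<exists>t\<in>{1..q}. x \<in> I t \<and> y \<in> I t) \<longleftrightarrow> rank x = rank y"
      using xy rank_range[OF xy(1)] unfolding I_def by (simp del: atLeastAtMost_iff) metis
    also have "\<dots> \<longleftrightarrow> x = y \<or> (\<exists>(p, r)\<in>S. p \<le> min x y \<and> max x y \<le> r)"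
      using same_block[OF xy] same_block[OF xy(2,1)]
      by (cases "x \<le> y") (auto simp: min_def max_def)
    finally show ?thesis by (simp add: chain_matrix_def)
  qed
  moreover have "card (I t) \<le> card (I (t + 1))" if t: "1 \<le> t" "t < q" for t
  proof -
    have "t \<in> rank ` B" "t + 1 \<in> rank ` B" unfolding onto using t by auto
    then obtain b c where b: "b \<in> B" "rank b = t" and c: "c \<in> B" "rank c = t + 1"
      by (metis imageE)
    have fin: "finite (I u)" for u by (simp add: I_def)
    have "c \<in> {1..n}" using c by (simp add: B_def)
    have "b < c" by (rule ccontr) (use mono[of c b] b c in simp)
    show ?thesis
    \<comment> \<open>\<open>b\<close> and \<open>c\<close> are the first elements of the blocks \<open>t\<close> and \<open>t + 1\<close>. If \<open>b\<close> is not the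
      left end of an interval in \<open>S\<close>, then block \<open>t\<close> is the singleton \<open>{b}\<close>.\<close>
    proof (cases "\<exists>r. (b, r) \<in> S")
      case True
      then obtain r where r: "(b, r) \<in> S" by blast
      have br: "b < r" "r \<le> n" "b \<in> {1..n}" using cdw_chainD(1)[OF S r] by auto
      have "rank r = t" using same_block[of b r] b r br by force
      then have "r < c" using mono[of c r] c by (cases "c \<le> r") auto
      then have "r < n" using \<open>c \<in> {1..n}\<close> by simp
      then obtain j where j: "(r + 1, j) \<in> S" "2 * r + 1 \<le> j + b"
        using cdw_chainD(3)[OF S r] by blast
      have jr: "r + 1 < j" "j \<le> n" using cdw_chainD(1)[OF S j(1)] by auto
      have start: "r + 1 \<in> B" using cdw_chainD(2)[OF S j(1)] jr \<open>r < n\<close>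
        by (fastforce simp: B_def)
      have "rank (r + 1) = t + 1"
        using strict[of r "r + 1" "r + 1"] start \<open>rank r = t\<close> mono[of "r + 1" c] \<open>r < c\<close> c
        by simp
      have "I t \<subseteq> {b..r}"
      proof
        fix x assume "x \<in> I t"
        then have x: "rank x = t" "x \<in> {1..n}" by (auto simp: I_def)
        show "x \<in> {b..r}"
          using strict[of x b b] strict[of r "r + 1" x] b x start \<open>rank r = t\<close>
          by (metis Suc_eq_plus1 atLeastAtMost_iff less_irrefl not_le not_less_eq_eq order_refl)
      qed
      then have "card (I t) \<le> card {b..r}" by (intro card_mono) auto
      also have "\<dots> \<le> card {r + 1..j}" using j by simp
      also have "\<dots> \<le> card (I (t + 1))"
      proof (intro card_mono fin subsetI)
        fix x assume x: "x \<in> {r + 1..j}"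
        then have "rank (r + 1) = rank x"
          using same_block[of "r + 1" x] j jr by force
        then show "x \<in> I (t + 1)" using x jr \<open>rank (r + 1) = t + 1\<close> by (simp add: I_def)
      qed
      finally show ?thesis .
    next
      case False
      have "I t \<subseteq> {b}"
      proof
        fix x assume "x \<in> I t"
        then have x: "rank x = t" "x \<in> {1..n}" by (auto simp: I_def)
        have "b \<le> x" by (rule ccontr) (use strict[of x b b] b x in simp)
        then have "b = x \<or> (\<exists>(p, r)\<in>S. p \<le> b \<and> x \<le> r)"
          using same_block[of b x] x b by (auto simp: B_def)
        moreover have "\<not> (p \<le> b \<and> x \<le> r)" if "(p, r) \<in> S" "b \<noteq> x" for p r
          using that b(1) False \<open>b \<le> x\<close> by (cases "p = b") (fastforce simp: B_def)+
        ultimately show "x \<in> {b}" by auto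
      qed
      then have "card (I t) \<le> card {b}" by (intro card_mono) auto
      also have "\<dots> \<le> card (I (t + 1))"
        using fin \<open>c \<in> {1..n}\<close> c by (auto simp: I_def card_gt_0_iff Suc_le_eq)
      finally show ?thesis .
    qed
  qed
  ultimately show ?thesis
    unfolding cdw_cut_matrix_def cut_matrix_of_def using part by blast
qed

text \<open>The blocks of a chain are disjoint, so at most one term of the double sum is nonzero.\<close>
lemma chain_matrix_off_diagonal:
  assumes S: "cdw_chain n S" and xy: "x < y"
  shows "a * chain_matrix S x y
       = a - (\<Sum>p = 1..x. \<Sum>r = y..n. if (p, r) \<in> S then a else 0)"
proof -
  have "(\<Sum>p = 1..x. \<Sum>r = y..n. if (p, r) \<in> S then a else 0)
      = (\<Sum>z\<in>{1..x} \<times> {y..n}. if z \<in> S then a else 0)"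
    by (simp add: sum.cartesian_product)
  also have "\<dots> = (if \<exists>z\<in>{1..x} \<times> {y..n}. z \<in> S then a else 0)"
  proof (rule sum_if_unique)
    fix u v assume "u \<in> {1..x} \<times> {y..n}" "v \<in> {1..x} \<times> {y..n}" "u \<in> S" "v \<in> S"
    then show "u = v" using cdw_chainD(2)[OF S] xy by (cases u; cases v) fastforce
  qed simp
  also have "(\<exists>z\<in>{1..x} \<times> {y..n}. z \<in> S) \<longleftrightarrow> (\<exists>(p, r)\<in>S. p \<le> x \<and> y \<le> r)"
    using cdw_chainD(1)[OF S] by fastforce
  finally show ?thesis using xy by (simp add: chain_matrix_def)
qed

lemma conic_combination_sum_list:
  assumes "\<And>a S. (a, S) \<in> set L \<Longrightarrow> 0 \<le> a \<and> P (F S)"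
  shows "conic_combination n P (\<lambda>x y. \<Sum>(a, S)\<leftarrow>L. a * F S x y)"
  unfolding conic_combination_def
proof (intro exI conjI allI impI ballI)
  fix t assume "t < length L"
  then show "0 \<le> fst (L ! t)" "P (F (snd (L ! t)))"
    using assms[of "fst (L ! t)" "snd (L ! t)"] by auto
next
  fix x y
  show "(\<Sum>(a, S)\<leftarrow>L. a * F S x y) = (\<Sum>t<length L. fst (L ! t) * F (snd (L ! t)) x y)"
    by (simp add: sum_list_sum_nth case_prod_unfold atLeast0LessThan)
qed

section \<open>The characterisation\<close>

text \<open>
  The conic combination \<open>K\<close> of the chain matrices has the same interval weights as \<open>C\<close>, and by
  \<open>cut_weight_quadrant_sum\<close> these determine the off-diagonal entries up to a common constant.
  The diagonal of \<open>C\<close> is absorbed by the weak constant matrix.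
\<close>
lemma representable_if_hall:
  assumes sym: "symmetric_matrix n C" and kal: "kalmanson_matrix n C" and rob: "robinson_matrix n C"
    and hall: "\<And>k l. \<lbrakk>1 \<le> l; l < k; k < n\<rbrakk> \<Longrightarrow>
      (\<Sum>i = 1..l. cut_weight n C i k) \<le> (\<Sum>j = 2 * k + 1 - l..n. cut_weight n C (k + 1) j)"
  shows "\<exists>W K. weak_constant_matrix n W \<and> conic_combination n (cdw_cut_matrix n) K \<and>
            (\<forall>i\<in>{1..n}. \<forall>j\<in>{1..n}. C i j = W i j + K i j)"
proof -
  have "\<exists>L. (\<forall>(a, S)\<in>set L. 0 \<le> a \<and> cdw_chain n S)
      \<and> (\<forall>p r. chain_load L p r = cut_weight n C p r)"
    using cut_weight_nonneg[OF kal rob] cut_weight_nonzero_range hall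
    by (rule chain_decomposition)
  then obtain L where L: "\<And>a S. (a, S) \<in> set L \<Longrightarrow> 0 \<le> a \<and> cdw_chain n S"
    and load: "\<And>p r. chain_load L p r = cut_weight n C p r" by fast
  define K where "K = (\<lambda>x y. \<Sum>(a, S)\<leftarrow>L. a * chain_matrix S x y)"
  define A where "A = (\<Sum>(a, S)\<leftarrow>L. a)"
  have upper: "C x y - K x y = C 1 n - A" if xy: "1 \<le> x" "x < y" "y \<le> n" for x y
  proof -
    have "K x y = (\<Sum>(a, S)\<leftarrow>L. a - (\<Sum>p = 1..x. \<Sum>r = y..n. if (p, r) \<in> S then a else 0))"
      unfolding K_def using L chain_matrix_off_diagonal[OF _ xy(2)]
      by (intro arg_cong[of _ _ sum_list] map_cong) auto
    also have "\<dots> = A - (\<Sum>p = 1..x. \<Sum>r = y..n. chain_load L p r)"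
      unfolding A_def chain_load_def
      by (simp add: sum_sum_list_swap case_prod_unfold sum_list_subtractf)
    finally show ?thesis using cut_weight_quadrant_sum[OF sym xy] by (simp add: load)
  qed
  have Ksym: "K x y = K y x" for x y
    unfolding K_def chain_matrix_def by (simp add: min.commute max.commute eq_commute)
  have "C x y - K x y = C 1 n - A" if "x \<in> {1..n}" "y \<in> {1..n}" "x \<noteq> y" for x y
    using upper[of x y] upper[of y x] Ksym[of x y] sym that
    by (cases "x < y") (auto simp: symmetric_matrix_def)
  then have "weak_constant_matrix n (\<lambda>x y. C x y - K x y)"
    unfolding weak_constant_matrix_def constant_matrix_def
    by (intro exI[of _ "\<lambda>_ _. C 1 n - A"]) auto
  moreover have "conic_combination n (cdw_cut_matrix n) K"
    unfolding K_def by (rule conic_combination_sum_list) (use L chain_matrix_cdw in blast)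
  ultimately show ?thesis
    by (intro exI[of _ "\<lambda>x y. C x y - K x y"] exI[of _ K]) auto
qed

theorem theorem4p6:
  fixes n :: nat and C :: "nat \<Rightarrow> nat \<Rightarrow> real"
  assumes "symmetric_matrix n C"
    and "kalmanson_matrix n C"
    and "robinson_matrix n C"
  shows "(\<exists>W K. weak_constant_matrix n W \<and> conic_combination n (cdw_cut_matrix n) K \<and>
            (\<forall>i\<in>{1..n}. \<forall>j\<in>{1..n}. C i j = W i j + K i j))
     \<longleftrightarrow>
         (\<forall>k\<in>{2..n - 1}. \<forall>l\<in>{1..k - 1}.
            (\<Sum>i = 1..l. cut_weight n C i k)
              \<le> (\<Sum>j = 2 * k + 1 - l..n. cut_weight n C (k + 1) j))"
    (is "?rep \<longleftrightarrow> ?hall")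
proof
  assume ?rep
  then obtain W K where "weak_constant_matrix n W" "conic_combination n (cdw_cut_matrix n) K"
    "\<And>i j. \<lbrakk>i \<in> {1..n}; j \<in> {1..n}\<rbrakk> \<Longrightarrow> C i j = W i j + K i j" by blast
  then have rep: "\<And>k l. \<lbrakk>1 \<le> l; l < k; k < n\<rbrakk> \<Longrightarrow> hall_inequality n C k l"
    by (rule hall_if_representable)
  show ?hall
  proof (intro ballI)
    fix k l assume "k \<in> {2..n - 1}" "l \<in> {1..k - 1}"
    then have l: "1 \<le> l" "l < k" "k < n" by auto
    show "(\<Sum>i = 1..l. cut_weight n C i k) \<le> (\<Sum>j = 2 * k + 1 - l..n. cut_weight n C (k + 1) j)"
      using rep[OF l] hall_inequality_iff_cut_weight[OF assms(1) l] by blast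
  qed
next
  assume hall: ?hall
  show ?rep
  proof (rule representable_if_hall[OF assms])
    fix k l :: nat assume "1 \<le> l" "l < k" "k < n"
    then have "k \<in> {2..n - 1}" "l \<in> {1..k - 1}" by auto
    then show "(\<Sum>i = 1..l. cut_weight n C i k)
        \<le> (\<Sum>j = 2 * k + 1 - l..n. cut_weight n C (k + 1) j)"
      using hall by blast
  qed
qed

end
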